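(* For every $n\in\mathbb{N}$ we have $\{1\}\cup\mathbb{P}(1,n)\in CS_1^{max}(n)$ and $\{1\}\cup\mathbb{P}(1,n)\cup\{p^2:p\in\mathbb{P}(1,\sqrt{n})\}\in CS_2^{max}(n)$.
   Context: $\mathbb{N}$ is the set of positive integers, $\mathbb{P}$ the set of primes, $[n]:=\{1,2,\dots,n\}$, and $\mathbb{P}(x,y):=\mathbb{P}\cap(x,y]$ for real $x,y$. For a finite set $A\subseteq\mathbb{N}$ and a prime $p$, $o_p(A):=|A\cap p\mathbb{N}|$ is the number of elements of $A$ divisible by $p$. For positive integers $k,n$ define $CS_k(n):=\{A\subseteq[n]: o_p(A)\leq k\text{ for all }p\in\mathbb{P}\}$, and let $CS_k^{max}(n)$ be the set of elements of $CS_k(n)$ of maximal cardinality. *)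

theory Defs
  imports Complex_Main "HOL-Computational_Algebra.Primes"
begin

definition primes_between :: "real \<Rightarrow> real \<Rightarrow> nat set" where
  "primes_between x y = {p. prime p \<and> x < real p \<and> real p \<le> y}"

definition occ :: "nat \<Rightarrow> nat set \<Rightarrow> nat" where
  "occ p A = card {a \<in> A. p dvd a}"

definition CS :: "nat \<Rightarrow> nat \<Rightarrow> nat set set" where
  "CS k n = {A. A \<subseteq> {1..n} \<and> (\<forall>p. prime p \<longrightarrow> occ p A \<le> k)}"

definition CS_max :: "nat \<Rightarrow> nat \<Rightarrow> nat set set" where
  "CS_max k n = {A \<in> CS k n. \<forall>B \<in> CS k n. card B \<le> card A}"

end

(* Every element of [n] other than 1 and the primes in (sqrt n, n] has a prime divisor in (1, sqrt n].
   If each prime divides at most two elements of B, then at most 2 * |P(1, sqrt n)| elements of B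
   arise in this way, and 1 + |P(1, n)| - |P(1, sqrt n)| others remain. For k = 1 it suffices that
   every element other than 1 has some prime divisor. *)
theory Submission
  imports Defs
begin

lemma primes_between_1_eq: "primes_between 1 (real n) = {p. prime p \<and> p \<le> n}"
  by (auto simp: primes_between_def dest: prime_gt_1_nat)

lemma primes_between_1_sqrt_eq:
  "primes_between 1 (sqrt (real n)) = {p. prime p \<and> p\<^sup>2 \<le> n}"
proof -
  have "real p \<le> sqrt (real n) \<longleftrightarrow> p\<^sup>2 \<le> n" for p
    by (metis of_nat_0_le_iff of_nat_le_iff of_nat_power real_le_lsqrt real_sqrt_abs
        real_sqrt_le_iff abs_of_nat)
  then show ?thesis
    by (auto simp: primes_between_def dest: prime_gt_1_nat)
qed

text \<open>Split \<open>a\<close> into two factors greater than 1 and take a prime divisor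
  \<open>p\<close> of the smaller one. Then \<open>p\<close> is at most each factor, so its square
  is at most their product.\<close>

lemma composite_nat_has_small_prime_divisor:
  fixes a :: nat
  assumes "a > 1" "\<not> prime a"
  obtains p where "prime p" "p dvd a" "p\<^sup>2 \<le> a"
proof -
  have small: "\<exists>p. prime p \<and> p dvd x * y \<and> p\<^sup>2 \<le> x * y" if "1 < x" "x \<le> y" for x y :: nat
  proof -
    obtain p where p: "prime p" "p dvd x"
      using \<open>1 < x\<close> prime_factor_nat[of x] by auto
    then have "p \<le> x"
      using \<open>1 < x\<close> by (auto intro: dvd_imp_le)
    then have "p\<^sup>2 \<le> x * y"
      unfolding power2_eq_square using \<open>x \<le> y\<close> by (intro mult_mono) auto
    with p show ?thesis by auto
  qed
  obtain x where "x dvd a" "x \<noteq> 1" "x \<noteq> a"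
    using assms by (auto simp: prime_nat_iff)
  then obtain y where "a = x * y" "1 < x" "1 < y"
    using assms(1) by (auto elim!: dvdE simp: nat_neq_iff)
  then show ?thesis
    using small[of x y] small[of y x] that by (cases "x \<le> y") (auto simp: mult.commute)
qed

text \<open>Union bound: \<open>C\<close> is covered by the sets of multiples of \<open>q\<close> in
  \<open>B\<close>, one for each \<open>q\<close> in \<open>Q\<close>, and each of them has at most
  \<open>k\<close> elements.\<close>

lemma card_le_if_prime_divisor_in:
  assumes "B \<in> CS k n" "finite Q" "\<And>q. q \<in> Q \<Longrightarrow> prime q"
    and "\<And>a. a \<in> C \<Longrightarrow> \<exists>q\<in>Q. q dvd a" "C \<subseteq> B"
  shows "card C \<le> k * card Q"
proof -
  have fin: "finite B"
    using assms(1) unfolding CS_def by (auto intro: finite_subset)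
  have "card C \<le> card (\<Union>q\<in>Q. {a \<in> B. q dvd a})"
    using assms(2,4,5) fin by (intro card_mono) auto
  also have "\<dots> \<le> (\<Sum>q\<in>Q. card {a \<in> B. q dvd a})"
    using assms(2) by (rule card_UN_le)
  also have "\<dots> \<le> (\<Sum>q\<in>Q. k)"
    using assms(1,3) by (intro sum_mono) (auto simp: CS_def occ_def)
  finally show ?thesis by (simp add: mult.commute)
qed

lemma card_CS_1_le:
  assumes "B \<in> CS 1 n"
  shows "card B \<le> 1 + card {p. prime p \<and> p \<le> n}"
proof -
  have sub: "B \<subseteq> {1..n}"
    using assms by (auto simp: CS_def)
  have "\<exists>q\<in>{p. prime p \<and> p \<le> n}. q dvd a" if "a \<in> B - {1}" for a
  proof -
    have "a \<noteq> 1" "a \<le> n" "a > 0"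
      using that sub by auto
    then show ?thesis
      using prime_factor_nat[of a] dvd_imp_le le_trans by blast
  qed
  then have "card (B - {1}) \<le> 1 * card {p. prime p \<and> p \<le> n}"
    by (intro card_le_if_prime_divisor_in[OF assms]) auto
  then show ?thesis
    using card_Diff1_le card_Suc_Diff1 by (cases "1 \<in> B") (auto simp: card_Diff_singleton)
qed

lemma card_CS_2_le:
  assumes "B \<in> CS 2 n"
  shows "card B \<le> 1 + card {p. prime p \<and> p \<le> n} + card {p. prime p \<and> p\<^sup>2 \<le> n}"
proof -
  define P S :: "nat set" where "P = {p. prime p \<and> p \<le> n}" and "S = {p. prime p \<and> p\<^sup>2 \<le> n}"
  have sub: "B \<subseteq> {1..n}"
    using assms by (auto simp: CS_def)
  have fin: "finite P"
    by (simp add: P_def)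
  have "S \<subseteq> P"
    by (auto simp: P_def S_def power2_eq_square intro: le_trans[OF le_square])
  then have "finite S"
    using fin finite_subset by blast
  define C where "C = B - insert 1 (P - S)"
  have "\<exists>q\<in>S. q dvd a" if "a \<in> C" for a
  proof (cases "prime a")
    case True
    \<comment> \<open>A prime in \<open>C\<close> lies in \<open>P\<close> but was not removed with
      \<open>P - S\<close>, so it is small and serves as its own divisor.\<close>
    then have "a \<in> S"
      using that sub by (auto simp: C_def P_def)
    then show ?thesis
      using dvd_refl by blast
  next
    case False
    moreover have "a > 1" "a \<le> n"
      using that sub by (force simp: C_def)+
    ultimately show ?thesis
      by (metis (mono_tags, lifting) S_def composite_nat_has_small_prime_divisor le_trans
          mem_Collect_eq)
  qed
  then have "card C \<le> 2 * card S"
    using \<open>finite S\<close> by (intro card_le_if_prime_divisor_in[OF assms]) (auto simp: S_def C_def)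
  moreover have "card B \<le> card (insert 1 (P - S) \<union> C)"
    using fin finite_subset[OF sub] by (intro card_mono) (auto simp: C_def)
  moreover have "card (insert 1 (P - S) \<union> C) \<le> card (insert 1 (P - S)) + card C"
    by (rule card_Un_le)
  moreover have "card (insert 1 (P - S)) \<le> 1 + (card P - card S)"
    using fin \<open>finite S\<close> \<open>S \<subseteq> P\<close> by (simp add: card_insert_if card_Diff_subset)
  \<comment> \<open>Subtraction on naturals truncates; this inequality lets 1 + (|P| - |S|) + 2|S|
    collapse to 1 + |P| + |S|.\<close>
  moreover have "card S \<le> card P"
    using fin \<open>S \<subseteq> P\<close> by (rule card_mono)
  ultimately show ?thesis
    unfolding P_def[symmetric] S_def[symmetric] by linarith
qed

text \<open>The set attains the bound of \<open>card_CS_1_le\<close>, so it is maximal as soon as it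
  belongs to \<open>CS 1 n\<close>.\<close>

lemma one_primes_in_CS_max_1:
  assumes "n \<ge> 1"
  shows "{1} \<union> {p. prime p \<and> p \<le> n} \<in> CS_max 1 n"
proof -
  let ?A = "{1} \<union> {p. prime p \<and> p \<le> n}"
  have "occ p ?A \<le> 1" if "prime p" for p
  proof -
    have "{a \<in> ?A. p dvd a} \<subseteq> {p}"
      using that by (auto dest: primes_dvd_imp_eq)
    then show ?thesis
      unfolding occ_def by (metis card_mono finite.emptyI finite_insert is_singletonI is_singleton_altdef)
  qed
  \<comment> \<open>The assumption \<open>n \<ge> 1\<close> puts the element 1 into the
    interval.\<close>
  moreover have "?A \<subseteq> {1..n}"
    using assms by (auto dest: prime_ge_1_nat)
  moreover have "card ?A = 1 + card {p. prime p \<and> p \<le> n}"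
    by simp
  ultimately show ?thesis
    unfolding CS_max_def using card_CS_1_le by (auto simp: CS_def)
qed

text \<open>Each small prime contributes its square as one further element, which raises the size to
  exactly the bound of \<open>card_CS_2_le\<close>.\<close>

lemma one_primes_prime_squares_in_CS_max_2:
  assumes "n \<ge> 1"
  shows "{1} \<union> {p. prime p \<and> p \<le> n} \<union> {p\<^sup>2 | p. prime p \<and> p\<^sup>2 \<le> n} \<in> CS_max 2 n"
proof -
  define P S :: "nat set" where "P = {p. prime p \<and> p \<le> n}" and "S = {p. prime p \<and> p\<^sup>2 \<le> n}"
  define A where "A = insert 1 P \<union> power2 ` S"
  have A_eq: "{1} \<union> {p. prime p \<and> p \<le> n} \<union> {p\<^sup>2 | p. prime p \<and> p\<^sup>2 \<le> n} = A"
    by (auto simp: A_def P_def S_def)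
  have "occ p A \<le> 2" if "prime p" for p
  proof -
    \<comment> \<open>A prime \<open>p\<close> does not divide 1, and it divides a prime
      \<open>q\<close> or its square only if \<open>p = q\<close>.\<close>
    have "{a \<in> A. p dvd a} \<subseteq> {p, p\<^sup>2}"
      using that by (auto simp: A_def P_def S_def dest: prime_dvd_power primes_dvd_imp_eq)
    then have "occ p A \<le> card {p, p\<^sup>2}"
      unfolding occ_def by (intro card_mono) auto
    also have "\<dots> \<le> 2"
      by (simp add: card_insert_if)
    finally show ?thesis .
  qed
  moreover have "A \<subseteq> {1..n}"
    using assms by (auto simp: A_def P_def S_def Suc_le_eq dest: prime_gt_0_nat)
  moreover have "card A = 1 + card P + card S"
  proof -
    have fin: "finite P"
      by (simp add: P_def)
    have "S \<subseteq> P"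
      by (auto simp: P_def S_def power2_eq_square intro: le_trans[OF le_square])
    then have "finite (power2 ` S)"
      using fin finite_subset by blast
    \<comment> \<open>The square of a prime is neither 1 nor prime, so the cardinalities add without
      overlap.\<close>
    moreover have "insert 1 P \<inter> power2 ` S = {}"
      using not_prime_1 by (auto simp: P_def S_def prime_power_iff dest: sym)
    moreover have "inj_on power2 S"
      by (auto simp: inj_on_def)
    moreover have "1 \<notin> P"
      by (simp add: P_def)
    ultimately show ?thesis
      unfolding A_def using fin by (simp add: card_Un_disjoint card_image)
  qed
  ultimately show ?thesis
    unfolding A_eq CS_max_def using card_CS_2_le by (auto simp: CS_def P_def S_def)
qed

theorem proposition2:
  fixes n :: nat
  assumes "n \<ge> 1"
  shows "{1} \<union> primes_between 1 (real n) \<in> CS_max 1 n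
    \<and> {1} \<union> primes_between 1 (real n) \<union> {p\<^sup>2 | p. p \<in> primes_between 1 (sqrt (real n))} \<in> CS_max 2 n"
  using one_primes_in_CS_max_1[OF assms] one_primes_prime_squares_in_CS_max_2[OF assms]
  by (simp add: primes_between_1_eq primes_between_1_sqrt_eq)

end
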